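(* Let $p(x,y,z)$ be a polynomial with real coefficients, let $a_1<a_2$, $b_1<b_2$, $c_1<c_2$ be real numbers, and let $$\Pi=\{(x,y,z)\in\mathbb{R}^3\mid a_1\le x\le a_2,\ b_1\le y\le b_2,\ c_1\le z\le c_2\}.$$ Let $\operatorname{Argmin}p(\Pi)=\{(x,y,z)\in\Pi\mid p(x,y,z)=\min p(\Pi)\}$ be the set of global minimum points of $p$ on $\Pi$, let $\operatorname{bd}\Pi$ be the set of boundary points of $\Pi$, and let $$x^*=\min\{x\mid (x,y,z)\in\operatorname{Argmin}p(\Pi)\}.$$ Then one of the following two cases holds: 1. $\operatorname{bd}\Pi\cap\operatorname{Argmin}p(\Pi)\ne\emptyset$; 2. $\operatorname{bd}\Pi\cap\operatorname{Argmin}p(\Pi)=\emptyset$, and the value $x^*$ is one of the local minimum values in the problem $$x\to\min;\quad \frac{\partial p(x,y,z)}{\partial x}=0,\ \frac{\partial p(x,y,z)}{\partial y}=0,\ \frac{\partial p(x,y,z)}{\partial z}=0 .$$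
   Context: The boundary $\operatorname{bd}\Pi$ is the set of points $(x,y,z)\in\Pi$ with $x\in\{a_1,a_2\}$ or $y\in\{b_1,b_2\}$ or $z\in\{c_1,c_2\}$. Also $\min p(\Pi)$ denotes the minimum value of $p$ on $\Pi$. A problem written "$f\to\min;$ (constraints)" means minimizing $f$ over the feasible set $S\subseteq\mathbb{R}^3$ of all points satisfying the constraints. A local minimum point in this problem is a point $w^*\in S$ for which there is a neighborhood $V$ of $w^*$ in $\mathbb{R}^3$ with $f(w)\ge f(w^* )$ for all $w\in S\cap V$. A local minimum value is the value $f(w^* )$ of the objective at some local minimum point $w^*$. *)

theory Defs
  imports "HOL-Analysis.Analysis"
begin

definition Pi_box :: "real \<Rightarrow> real \<Rightarrow> real \<Rightarrow> real \<Rightarrow> real \<Rightarrow> real \<Rightarrow> (real \<times> real \<times> real) set" where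
  "Pi_box a1 a2 b1 b2 c1 c2 =
     {(x, y, z). a1 \<le> x \<and> x \<le> a2 \<and> b1 \<le> y \<and> y \<le> b2 \<and> c1 \<le> z \<and> z \<le> c2}"

definition bd_box :: "real \<Rightarrow> real \<Rightarrow> real \<Rightarrow> real \<Rightarrow> real \<Rightarrow> real \<Rightarrow> (real \<times> real \<times> real) set" where
  "bd_box a1 a2 b1 b2 c1 c2 =
     {(x, y, z). (x, y, z) \<in> Pi_box a1 a2 b1 b2 c1 c2 \<and>
        (x \<in> {a1, a2} \<or> y \<in> {b1, b2} \<or> z \<in> {c1, c2})}"

(* Min is only meaningful on finite sets. The lemma least_elem_compact below shows that
   least_elem is the minimum wherever it is used here. *)
definition least_elem :: "real set \<Rightarrow> real" where
  "least_elem A = (LEAST m. m \<in> A)"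

definition Argmin :: "('a \<Rightarrow> real) \<Rightarrow> 'a set \<Rightarrow> 'a set" where
  "Argmin f S = {w \<in> S. f w = least_elem (f ` S)}"

definition local_min_point :: "('a::topological_space \<Rightarrow> real) \<Rightarrow> 'a set \<Rightarrow> 'a \<Rightarrow> bool" where
  "local_min_point f S w \<longleftrightarrow>
     w \<in> S \<and> (\<exists>V. open V \<and> w \<in> V \<and> (\<forall>u \<in> S \<inter> V. f u \<ge> f w))"

definition local_min_values :: "('a::topological_space \<Rightarrow> real) \<Rightarrow> 'a set \<Rightarrow> real set" where
  "local_min_values f S = {f w | w. local_min_point f S w}"

definition dx :: "(real \<times> real \<times> real \<Rightarrow> real) \<Rightarrow> real \<times> real \<times> real \<Rightarrow> real" where
  "dx p = (\<lambda>(x, y, z). deriv (\<lambda>t. p (t, y, z)) x)"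

definition dy :: "(real \<times> real \<times> real \<Rightarrow> real) \<Rightarrow> real \<times> real \<times> real \<Rightarrow> real" where
  "dy p = (\<lambda>(x, y, z). deriv (\<lambda>t. p (x, t, z)) y)"

definition dz :: "(real \<times> real \<times> real \<Rightarrow> real) \<Rightarrow> real \<times> real \<times> real \<Rightarrow> real" where
  "dz p = (\<lambda>(x, y, z). deriv (\<lambda>t. p (x, y, t)) z)"

lemma least_elem_compact:
  assumes "compact A" "A \<noteq> {}"
  shows "least_elem A \<in> A" and "\<And>a. a \<in> A \<Longrightarrow> least_elem A \<le> a"
proof -
  obtain m where m: "m \<in> A" "\<And>a. a \<in> A \<Longrightarrow> m \<le> a"
    using compact_attains_inf[OF assms] by blast
  then have "least_elem A = m"
    unfolding least_elem_def by (intro Least_equality)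
  with m show "least_elem A \<in> A" and "\<And>a. a \<in> A \<Longrightarrow> least_elem A \<le> a"
    by simp_all
qed

lemma compact_Pi_box: "compact (Pi_box a1 a2 b1 b2 c1 c2)"
proof -
  have "Pi_box a1 a2 b1 b2 c1 c2 = {a1..a2} \<times> {b1..b2} \<times> {c1..c2}"
    by (auto simp: Pi_box_def)
  then show ?thesis
    by (simp add: compact_Times)
qed

lemma compact_Argmin:
  fixes f :: "'a::t2_space \<Rightarrow> real"
  assumes "compact S" "S \<noteq> {}" "continuous_on S f"
  shows "compact (Argmin f S)" and "Argmin f S \<noteq> {}"
proof -
  have "closedin (top_of_set S) (S \<inter> f -` {least_elem (f ` S)})"
    using assms(3) by (intro continuous_closedin_preimage) simp_all
  moreover have "Argmin f S = S \<inter> f -` {least_elem (f ` S)}"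
    by (auto simp: Argmin_def)
  ultimately show "compact (Argmin f S)"
    using assms(1) closedin_compact by metis
  have "least_elem (f ` S) \<in> f ` S"
    using assms by (intro least_elem_compact(1) compact_continuous_image) simp_all
  then show "Argmin f S \<noteq> {}"
    by (auto simp: Argmin_def)
qed

end

theory Submission
  imports Defs "HOL-Computational_Algebra.Polynomial"
begin

text \<open>
The theorem rests on the fact that a polynomial on a Euclidean space has only finitely many critical
values (\<open>finite_critical_values\<close>). Suppose that no minimum point lies on the boundary, and let \<open>w\<close>
be one with least first coordinate. It is an interior point of the box, hence critical. As the
critical values are finite in number, near \<open>w\<close> every critical point has the critical value \<open>p w\<close>; so it is
itself a global minimum point, and its first coordinate is not below that of \<open>w\<close>.

Finiteness is proved with derivations. If there were infinitely many critical values, there would be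
a sequence of critical points \<open>w n\<close> whose values \<open>t n = p (w n)\<close> are pairwise distinct. In an
ultrapower of the reals, which is a field of characteristic 0, the class of \<open>t\<close> is transcendental
over the reals (\<open>ultra_transcendental\<close>). Hence the derivation \<open>d/dt\<close> of the polynomials in \<open>t\<close>
extends to a derivation \<open>D\<close> of a larger ring that also contains the classes of the coordinates of
\<open>w\<close> (\<open>derivation_of_transcendental\<close>). By the chain rule (\<open>polynomial_chain_rule\<close>), \<open>D t\<close> is a linear
combination of the partial derivatives of \<open>p\<close> along \<open>w\<close>, all of which vanish; but \<open>D t = 1\<close>.
\<close>

section \<open>Extending derivations to ring extensions inside a field\<close>

text \<open>The values of \<open>D\<close> may leave the ring \<open>L\<close>: extending to an algebraic element requires
  a division, which is carried out in the surrounding field, so that \<open>L\<close> never has to be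
  enlarged to a field.\<close>

locale subring_derivation =
  fixes L :: "'a::field_char_0 set" and D :: "'a \<Rightarrow> 'a"
  assumes one_closed: "1 \<in> L"
    and diff_closed: "a \<in> L \<Longrightarrow> b \<in> L \<Longrightarrow> a - b \<in> L"
    and mult_closed: "a \<in> L \<Longrightarrow> b \<in> L \<Longrightarrow> a * b \<in> L"
    and D_add: "a \<in> L \<Longrightarrow> b \<in> L \<Longrightarrow> D (a + b) = D a + D b"
    and D_mult: "a \<in> L \<Longrightarrow> b \<in> L \<Longrightarrow> D (a * b) = D a * b + a * D b"
begin

lemma zero_closed: "0 \<in> L"
  using diff_closed[OF one_closed one_closed] by simp

lemma minus_closed: "a \<in> L \<Longrightarrow> - a \<in> L"
  using diff_closed[OF zero_closed, of a] by simp

lemma add_closed: "a \<in> L \<Longrightarrow> b \<in> L \<Longrightarrow> a + b \<in> L"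
  using diff_closed[OF _ minus_closed, of a b] by simp

lemma sum_closed: "(\<And>i. i \<in> I \<Longrightarrow> f i \<in> L) \<Longrightarrow> sum f I \<in> L"
  by (induction I rule: infinite_finite_induct) (auto intro: zero_closed add_closed)

lemma D_0: "D 0 = 0"
  using D_add[OF zero_closed zero_closed] by simp

lemma D_1: "D 1 = 0"
  using D_mult[OF one_closed one_closed] by simp

lemma D_sum: "(\<And>i. i \<in> I \<Longrightarrow> f i \<in> L) \<Longrightarrow> D (sum f I) = (\<Sum>i\<in>I. D (f i))"
  by (induction I rule: infinite_finite_induct) (auto simp: D_0 D_add sum_closed)

definition polys :: "'a poly set" where
  "polys = {g. \<forall>i. coeff g i \<in> L}"

text \<open>The value that an extension of \<^term>\<open>D\<close> with \<^term>\<open>v\<close> at the point \<^term>\<open>a\<close> is forced to take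
  at \<^term>\<open>poly g a\<close>.\<close>

definition Dpoly :: "'a \<Rightarrow> 'a \<Rightarrow> 'a poly \<Rightarrow> 'a" where
  "Dpoly a v g = poly (map_poly D g) a + v * poly (pderiv g) a"

lemma coeff_map_D [simp]: "coeff (map_poly D g) i = D (coeff g i)"
  by (rule coeff_map_poly) (rule D_0)

lemma polys_diff: "g \<in> polys \<Longrightarrow> h \<in> polys \<Longrightarrow> g - h \<in> polys"
  by (auto simp: polys_def diff_closed)

lemma polys_add: "g \<in> polys \<Longrightarrow> h \<in> polys \<Longrightarrow> g + h \<in> polys"
  by (auto simp: polys_def add_closed)

lemma polys_mult: "g \<in> polys \<Longrightarrow> h \<in> polys \<Longrightarrow> g * h \<in> polys"
  by (auto simp: polys_def coeff_mult intro!: sum_closed mult_closed)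

lemma polys_monom: "c \<in> L \<Longrightarrow> monom c n \<in> polys"
  by (auto simp: polys_def zero_closed)

lemma polys_const: "c \<in> L \<Longrightarrow> [:c:] \<in> polys"
  using polys_monom[of c 0] by (simp add: monom_0)

lemma map_D_monom: "map_poly D (monom c n) = monom (D c) n"
  by (rule poly_eqI) (simp add: D_0)

lemma Dpoly_add:
  assumes "g \<in> polys" "h \<in> polys"
  shows "Dpoly a v (g + h) = Dpoly a v g + Dpoly a v h"
proof -
  have "map_poly D (g + h) = map_poly D g + map_poly D h"
    using assms by (intro poly_eqI) (auto simp: polys_def D_add)
  then show ?thesis
    by (simp add: Dpoly_def pderiv_add algebra_simps)
qed

lemma Dpoly_diff:
  assumes "g \<in> polys" "h \<in> polys"
  shows "Dpoly a v (g - h) = Dpoly a v g - Dpoly a v h"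
  using Dpoly_add[OF polys_diff[OF assms] assms(2), of a v] by simp

lemma Dpoly_mult:
  assumes "g \<in> polys" "h \<in> polys"
  shows "Dpoly a v (g * h) = Dpoly a v g * poly h a + poly g a * Dpoly a v h"
proof -
  have "map_poly D (g * h) = map_poly D g * h + g * map_poly D h"
    using assms
    by (intro poly_eqI)
      (simp add: polys_def coeff_mult D_sum mult_closed D_mult sum.distrib)
  then show ?thesis
    by (simp add: Dpoly_def pderiv_mult algebra_simps)
qed

lemma Dpoly_const: "c \<in> L \<Longrightarrow> Dpoly a v [:c:] = D c"
  using map_D_monom[of c 0] by (simp add: Dpoly_def monom_0)

lemma Dpoly_X: "Dpoly a v (monom 1 1) = v"
  by (simp add: Dpoly_def map_D_monom D_1 pderiv_monom poly_monom)

text \<open>Every element of \<open>L[a]\<close> is \<^term>\<open>poly g a\<close> for some \<^term>\<open>g\<close>, and sending it to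
  \<^term>\<open>Dpoly a v g\<close> obeys the Leibniz rule; so the only obstruction to the extension is
  that two polynomials may represent the same element, which by additivity is a condition on the
  polynomials vanishing at \<^term>\<open>a\<close>.\<close>

lemma extend_if_compatible:
  assumes compat: "\<And>g. g \<in> polys \<Longrightarrow> poly g a = 0 \<Longrightarrow> Dpoly a v g = 0"
  shows "\<exists>L' D'. subring_derivation L' D' \<and> L \<subseteq> L' \<and> a \<in> L' \<and> (\<forall>c\<in>L. D' c = D c) \<and> D' a = v"
proof -
  define L' where "L' = (\<lambda>g. poly g a) ` polys"
  define D' where "D' c = Dpoly a v (SOME g. g \<in> polys \<and> poly g a = c)" for c
  have D': "D' (poly g a) = Dpoly a v g" if g: "g \<in> polys" for g
  proof -
    define h where "h = (SOME h. h \<in> polys \<and> poly h a = poly g a)"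
    have h: "h \<in> polys \<and> poly h a = poly g a"
      unfolding h_def by (rule someI[of _ g]) (simp add: g)
    then have "Dpoly a v (h - g) = 0"
      by (intro compat polys_diff) (simp_all add: g)
    then show ?thesis
      using g h by (simp add: Dpoly_diff D'_def flip: h_def)
  qed
  have const: "c \<in> L' \<and> D' c = D c" if "c \<in> L" for c
    using D'[OF polys_const[OF that]] polys_const[OF that]
    by (force simp: L'_def Dpoly_const that)
  have "subring_derivation L' D'"
  proof
    show "1 \<in> L'"
      using const one_closed by blast
  next
    fix b c assume "b \<in> L'" "c \<in> L'"
    then obtain g h where gh: "g \<in> polys" "h \<in> polys" "b = poly g a" "c = poly h a"
      by (auto simp: L'_def)
    show "b - c \<in> L'"
      using gh polys_diff[of g h] by (force simp: L'_def)
    show "b * c \<in> L'"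
      using gh polys_mult[of g h] by (force simp: L'_def)
    show "D' (b + c) = D' b + D' c"
      using gh D'[OF polys_add[of g h]] by (simp add: D' Dpoly_add)
    show "D' (b * c) = D' b * c + b * D' c"
      using gh D'[OF polys_mult[of g h]] by (simp add: D' Dpoly_mult)
  qed
  moreover have "a \<in> L' \<and> D' a = v"
    using D'[OF polys_monom[OF one_closed, of 1]] polys_monom[OF one_closed, of 1]
    by (force simp: L'_def Dpoly_X[simplified] poly_monom)
  ultimately show ?thesis
    using const by blast
qed

text \<open>For algebraic \<^term>\<open>a\<close>, a nonzero polynomial \<^term>\<open>f\<close> of least degree vanishing at \<^term>\<open>a\<close> has
  \<^term>\<open>poly (pderiv f) a \<noteq> 0\<close>, by minimality and characteristic 0. The equation
  \<^term>\<open>Dpoly a v f = 0\<close> then determines \<^term>\<open>v\<close>, and pseudo-division by \<^term>\<open>f\<close> carries it over to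
  every other polynomial vanishing at \<^term>\<open>a\<close>.\<close>

lemma compatible_if_algebraic:
  assumes "f\<^sub>0 \<in> polys" "f\<^sub>0 \<noteq> 0" "poly f\<^sub>0 a = 0"
  shows "\<exists>v. \<forall>g\<in>polys. poly g a = 0 \<longrightarrow> Dpoly a v g = 0"
proof -
  obtain f where f: "f \<in> polys" "f \<noteq> 0" "poly f a = 0"
    and minimal: "\<And>g. g \<in> polys \<Longrightarrow> g \<noteq> 0 \<Longrightarrow> poly g a = 0 \<Longrightarrow> degree f \<le> degree g"
    using ex_has_least_nat[of "\<lambda>g. g \<in> polys \<and> g \<noteq> 0 \<and> poly g a = 0" f\<^sub>0 degree] assms by blast
  have deg: "degree f \<noteq> 0"
  proof
    assume "degree f = 0"
    then obtain c where "f = [:c:]"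
      by (rule degree_eq_zeroE)
    with f show False by simp
  qed
  have "pderiv f \<in> polys"
  proof -
    have "of_nat n \<in> L" for n
      by (induction n) (auto intro: zero_closed one_closed add_closed)
    then have "of_nat (Suc i) * coeff f (Suc i) \<in> L" for i
      using f(1) by (intro mult_closed) (auto simp: polys_def simp del: of_nat_Suc)
    then show ?thesis
      by (simp add: polys_def coeff_pderiv del: of_nat_Suc)
  qed
  then have "poly (pderiv f) a \<noteq> 0"
    using minimal[of "pderiv f"] deg by (auto simp: degree_pderiv pderiv_eq_0_iff)
  define v where "v = - poly (map_poly D f) a / poly (pderiv f) a"
  have Df: "Dpoly a v f = 0"
    using \<open>poly (pderiv f) a \<noteq> 0\<close> by (simp add: Dpoly_def v_def)
  have "Dpoly a v g = 0" if "g \<in> polys" "poly g a = 0" for g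
    using that
  proof (induction "degree g" arbitrary: g rule: less_induct)
    case less
    show ?case
    proof (cases "g = 0")
      case True
      then show ?thesis by (simp add: Dpoly_def)
    next
      case False
      then have le: "degree f \<le> degree g"
        using less.prems minimal by blast
      \<comment> \<open>One step of pseudo-division, which keeps the coefficients in \<^term>\<open>L\<close>.\<close>
      define m where "m = monom (lead_coeff g) (degree g - degree f)"
      define h where "h = [:lead_coeff f:] * g - m * f"
      have lc: "lead_coeff f \<in> L" "lead_coeff g \<in> L"
        using f less.prems by (auto simp: polys_def)
      have m: "m \<in> polys"
        unfolding m_def by (rule polys_monom) (rule lc)
      have c: "[:lead_coeff f:] \<in> polys"
        by (rule polys_const) (rule lc)
      have h: "h \<in> polys"
        unfolding h_def by (intro polys_diff polys_mult c m f less.prems)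
      have "poly h a = 0"
        using f less.prems by (simp add: h_def)
      have "Dpoly a v h = 0"
      proof (cases "h = 0")
        case True
        then show ?thesis by (simp add: Dpoly_def)
      next
        case h0: False
        have "degree m = degree g - degree f"
          using False by (simp add: m_def degree_monom_eq)
        then have "degree (m * f) \<le> degree g"
          using degree_mult_le[of m f] le by simp
        then have "degree h \<le> degree g"
          unfolding h_def by (intro degree_diff_le) auto
        moreover have "coeff h (degree g) = 0"
          using le by (simp add: h_def m_def coeff_monom_mult mult.commute[of "lead_coeff f"])
        ultimately have "degree h < degree g"
          using h0 by (metis le_neq_implies_less leading_coeff_0_iff)
        then show ?thesis
          using less.hyps h \<open>poly h a = 0\<close> by blast
      qed
      moreover have "Dpoly a v h = lead_coeff f * Dpoly a v g"
        using f less.prems m c by (simp add: h_def Dpoly_diff Dpoly_mult polys_mult Df del: mult_pCons_left)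
      ultimately show ?thesis
        using f by simp
    qed
  qed
  then show ?thesis by blast
qed

lemma extend:
  "\<exists>L' D'. subring_derivation L' D' \<and> L \<subseteq> L' \<and> a \<in> L' \<and> (\<forall>c\<in>L. D' c = D c)"
proof (cases "\<exists>f\<in>polys. f \<noteq> 0 \<and> poly f a = 0")
  case True
  then obtain v where "\<forall>g\<in>polys. poly g a = 0 \<longrightarrow> Dpoly a v g = 0"
    using compatible_if_algebraic by blast
  then show ?thesis
    using extend_if_compatible[of a v] by blast
next
  case False
  then have "Dpoly a 0 g = 0" if "g \<in> polys" "poly g a = 0" for g
    using that by (cases "g = 0") (auto simp: Dpoly_def)
  then show ?thesis
    using extend_if_compatible[of a 0] by blast
qed

end

lemma extend_derivation_finite:
  assumes "finite A" "subring_derivation L D"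
  shows "\<exists>L' D'. subring_derivation L' D' \<and> L \<subseteq> L' \<and> A \<subseteq> L' \<and> (\<forall>c\<in>L. D' c = D c)"
  using assms(1)
proof (induction A rule: finite_induct)
  case empty
  then show ?case using assms(2) by blast
next
  case (insert a A)
  then obtain L' D' where L': "subring_derivation L' D'" "L \<subseteq> L'" "A \<subseteq> L'" "\<forall>c\<in>L. D' c = D c"
    by blast
  obtain L'' D'' where "subring_derivation L'' D''" "L' \<subseteq> L''" "a \<in> L''" "\<forall>c\<in>L'. D'' c = D' c"
    using subring_derivation.extend[OF L'(1), of a] by blast
  with L' show ?case
    by (intro exI[of _ L''] exI[of _ D'']) auto
qed

text \<open>On \<open>k\<close> the zero derivation is taken. Only the zero polynomial over \<open>k\<close> vanishes at a
  transcendental element, so the value there can be prescribed.\<close>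

lemma derivation_of_transcendental:
  fixes k :: "'a::field_char_0 set"
  assumes "1 \<in> k" and "\<And>a b. a \<in> k \<Longrightarrow> b \<in> k \<Longrightarrow> a - b \<in> k \<and> a * b \<in> k"
    and transcendental: "\<And>g. (\<And>i. coeff g i \<in> k) \<Longrightarrow> poly g t = 0 \<Longrightarrow> g = 0"
    and "finite A"
  shows "\<exists>L D. subring_derivation L D \<and> k \<subseteq> L \<and> A \<subseteq> L \<and> t \<in> L \<and> (\<forall>c\<in>k. D c = 0) \<and> D t = 1"
proof -
  interpret k: subring_derivation k "\<lambda>_. 0"
  proof
    show "1 \<in> k" by (rule assms(1))
    show "a - b \<in> k" "a * b \<in> k" if "a \<in> k" "b \<in> k" for a b
      using assms(2)[OF that] by blast+
  qed simp_all
  have "k.Dpoly t 1 g = 0" if "g \<in> k.polys" "poly g t = 0" for g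
  proof -
    have "g = 0"
    proof (rule transcendental)
      show "coeff g i \<in> k" for i
        using that(1) unfolding k.polys_def by blast
    qed (rule that(2))
    then show ?thesis
      by (simp add: k.Dpoly_def)
  qed
  from k.extend_if_compatible[OF this]
  obtain L D where L: "subring_derivation L D" "k \<subseteq> L" "t \<in> L" "\<forall>c\<in>k. D c = 0" "D t = 1"
    by blast
  obtain L' D' where L': "subring_derivation L' D'" "L \<subseteq> L'" "A \<subseteq> L'" "\<forall>c\<in>L. D' c = D c"
    using extend_derivation_finite[OF \<open>finite A\<close> L(1)] by blast
  have "D' c = 0" if "c \<in> k" for c
    using that L(2,4) L'(4) by (metis subsetD)
  moreover have "D' t = 1"
    using L(3,5) L'(4) by metis
  moreover have "k \<subseteq> L'" "t \<in> L'"
    using L(2,3) L'(2) by blast+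
  ultimately show ?thesis
    using L'(1,3) by (intro exI[of _ L'] exI[of _ D'] conjI ballI)
qed

section \<open>An ultrapower of the reals\<close>

text \<open>A minimal proper filter below \<^term>\<open>sequentially\<close>, given by Zorn's lemma, decides every
  predicate: otherwise intersecting it with the predicate would make it strictly smaller.\<close>

lemma ex_free_ultrafilter:
  "\<exists>U. U \<noteq> bot \<and> U \<le> (sequentially :: nat filter) \<and>
    (\<forall>P. eventually P U \<or> eventually (\<lambda>n. \<not> P n) U)"
proof -
  define A where "A = {F. F \<noteq> bot \<and> F \<le> (sequentially :: nat filter)}"
  have "\<exists>U\<in>A. \<forall>F\<in>A. F \<le> U \<longrightarrow> F = U"
  proof (rule predicate_Zorn)
    show "partial_order_on A (relation_of (\<lambda>F G. G \<le> F) A)"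
      by (rule partial_order_on_relation_ofI) auto
  next
    fix C assume C: "C \<in> Chains (relation_of (\<lambda>F G. G \<le> F) A)"
    then have CA: "C \<subseteq> A" and chain: "\<And>F G. F \<in> C \<Longrightarrow> G \<in> C \<Longrightarrow> F \<le> G \<or> G \<le> F"
      by (auto simp: Chains_def relation_of_def)
    show "\<exists>U\<in>A. \<forall>F\<in>C. U \<le> F"
    proof (cases "C = {}")
      case True
      then show ?thesis by (auto simp: A_def intro: exI[of _ sequentially])
    next
      case False
      have "eventually (\<lambda>_. False) (Inf C) \<longleftrightarrow> (\<exists>F\<in>C. eventually (\<lambda>_. False) F)"
        using False
      proof (rule eventually_Inf_base)
        fix F G assume "F \<in> C" "G \<in> C"
        then show "\<exists>H\<in>C. H \<le> inf F G"
          using chain[of F G] by (auto simp: inf_absorb1 inf_absorb2)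
      qed
      then have "Inf C \<noteq> bot"
        using CA by (auto simp: A_def trivial_limit_def)
      moreover from False have "Inf C \<le> sequentially"
        using CA by (auto simp: A_def intro: Inf_lower2)
      ultimately show ?thesis
        by (auto simp: A_def intro!: bexI[of _ "Inf C"] Inf_lower)
    qed
  qed
  then obtain U where U: "U \<in> A" and min: "\<And>F. F \<in> A \<Longrightarrow> F \<le> U \<Longrightarrow> F = U"
    by blast
  have "eventually P U" if not: "\<not> eventually (\<lambda>n. \<not> P n) U" for P
  proof -
    have "inf U (principal {n. P n}) \<noteq> bot"
      using not by (simp add: trivial_limit_def eventually_inf_principal)
    then have "inf U (principal {n. P n}) = U"
      using U by (intro min) (auto simp: A_def intro: le_infI1)
    moreover have "eventually P (inf U (principal {n. P n}))"
      by (simp add: eventually_inf_principal)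
    ultimately show ?thesis by simp
  qed
  with U show ?thesis by (auto simp: A_def)
qed

definition free_ultrafilter :: "nat filter" where
  "free_ultrafilter = (SOME U. U \<noteq> bot \<and> U \<le> sequentially \<and>
    (\<forall>P. eventually P U \<or> eventually (\<lambda>n. \<not> P n) U))"

lemma free_ultrafilter_not_bot: "free_ultrafilter \<noteq> bot"
  and free_ultrafilter_le: "free_ultrafilter \<le> sequentially"
  and free_ultrafilter_cases:
    "eventually P free_ultrafilter \<or> eventually (\<lambda>n. \<not> P n) free_ultrafilter"
  using someI_ex[OF ex_free_ultrafilter] unfolding free_ultrafilter_def by auto

text \<open>The ultrapower is taken with respect to one fixed free ultrafilter. This loses nothing,
  because the sequences of interest are injective and it is enough that an event in the ultrafilter
  happens infinitely often.\<close>

quotient_type ultrareal = "nat \<Rightarrow> real" / "\<lambda>f g. \<forall>\<^sub>F n in free_ultrafilter. f n = g n"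
  morphisms rep_ultrareal ultra
proof (rule equivpI)
  show "reflp (\<lambda>f g :: nat \<Rightarrow> real. \<forall>\<^sub>F n in free_ultrafilter. f n = g n)"
    by (simp add: reflp_def)
  show "symp (\<lambda>f g :: nat \<Rightarrow> real. \<forall>\<^sub>F n in free_ultrafilter. f n = g n)"
    by (simp add: symp_def eq_commute)
  show "transp (\<lambda>f g :: nat \<Rightarrow> real. \<forall>\<^sub>F n in free_ultrafilter. f n = g n)"
    by (auto simp: transp_def elim: eventually_elim2)
qed

instantiation ultrareal :: field
begin

lift_definition zero_ultrareal :: ultrareal is "\<lambda>_. 0" .
lift_definition one_ultrareal :: ultrareal is "\<lambda>_. 1" .
lift_definition plus_ultrareal :: "ultrareal \<Rightarrow> ultrareal \<Rightarrow> ultrareal" is "\<lambda>f g n. f n + g n"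
  by (auto elim: eventually_elim2)
lift_definition minus_ultrareal :: "ultrareal \<Rightarrow> ultrareal \<Rightarrow> ultrareal" is "\<lambda>f g n. f n - g n"
  by (auto elim: eventually_elim2)
lift_definition times_ultrareal :: "ultrareal \<Rightarrow> ultrareal \<Rightarrow> ultrareal" is "\<lambda>f g n. f n * g n"
  by (auto elim: eventually_elim2)
lift_definition divide_ultrareal :: "ultrareal \<Rightarrow> ultrareal \<Rightarrow> ultrareal" is "\<lambda>f g n. f n / g n"
  by (auto elim: eventually_elim2)
lift_definition uminus_ultrareal :: "ultrareal \<Rightarrow> ultrareal" is "\<lambda>f n. - f n"
  by (auto elim: eventually_mono)
lift_definition inverse_ultrareal :: "ultrareal \<Rightarrow> ultrareal" is "\<lambda>f n. inverse (f n)"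
  by (auto elim: eventually_mono)

instance
proof
  fix a b c :: ultrareal
  show "a + b + c = a + (b + c)" by transfer (simp add: algebra_simps)
  show "a + b = b + a" by transfer (simp add: algebra_simps)
  show "0 + a = a" by transfer simp
  show "- a + a = 0" by transfer simp
  show "a - b = a + - b" by transfer simp
  show "a * b * c = a * (b * c)" by transfer (simp add: algebra_simps)
  show "a * b = b * a" by transfer (simp add: algebra_simps)
  show "1 * a = a" by transfer simp
  show "(a + b) * c = a * c + b * c" by transfer (simp add: algebra_simps)
  show "(0::ultrareal) \<noteq> 1" by transfer (simp add: free_ultrafilter_not_bot)
  show "a div b = a * inverse b" by transfer (simp add: divide_inverse)
  show "inverse (0::ultrareal) = 0" by transfer simp
  show "inverse a * a = 1" if "a \<noteq> 0"
    using that
  proof transfer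
    fix f :: "nat \<Rightarrow> real"
    assume "\<not> (\<forall>\<^sub>F n in free_ultrafilter. f n = 0)"
    then have "\<forall>\<^sub>F n in free_ultrafilter. f n \<noteq> 0"
      using free_ultrafilter_cases[of "\<lambda>n. f n = 0"] by blast
    then show "\<forall>\<^sub>F n in free_ultrafilter. inverse (f n) * f n = 1"
      by (auto elim: eventually_mono)
  qed
qed

end

lemma ultra_0: "ultra (\<lambda>_. 0) = 0" and ultra_1: "ultra (\<lambda>_. 1) = 1"
  by (transfer, simp)+

lemma ultra_add: "ultra (\<lambda>n. f n + g n) = ultra f + ultra g"
  and ultra_mult: "ultra (\<lambda>n. f n * g n) = ultra f * ultra g"
  and ultra_diff: "ultra (\<lambda>n. f n - g n) = ultra f - ultra g"
  by (transfer, simp)+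

lemma ultra_sum: "ultra (\<lambda>n. \<Sum>i\<in>I. f i n) = (\<Sum>i\<in>I. ultra (f i))"
  by (induction I rule: infinite_finite_induct) (simp_all add: ultra_0 ultra_add)

lemma ultra_eq_0_iff: "ultra f = 0 \<longleftrightarrow> (\<forall>\<^sub>F n in free_ultrafilter. f n = 0)"
  by transfer simp

instance ultrareal :: field_char_0
proof
  have of_nat: "(of_nat m :: ultrareal) = ultra (\<lambda>_. of_nat m)" for m
    by (induction m) (simp_all add: ultra_0 ultra_1 ultra_add)
  show "inj (of_nat :: nat \<Rightarrow> ultrareal)"
  proof (rule injI)
    fix m n assume "(of_nat m :: ultrareal) = of_nat n"
    then have "ultra (\<lambda>_. of_nat m - of_nat n) = 0"
      by (simp add: of_nat ultra_diff)
    then show "m = n"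
      by (simp add: ultra_eq_0_iff free_ultrafilter_not_bot)
  qed
qed

text \<open>A polynomial relation with real coefficients would hold at infinitely many, hence distinct,
  entries of the sequence.\<close>

lemma ultra_transcendental:
  assumes "inj t" and "\<And>i. coeff g i \<in> range (\<lambda>c. ultra (\<lambda>_. c))" and "poly g (ultra t) = 0"
  shows "g = 0"
proof -
  define star :: "real \<Rightarrow> ultrareal" where "star c = ultra (\<lambda>_. c)" for c
  have star_0: "star c = 0 \<longleftrightarrow> c = 0" for c
    by (simp add: star_def ultra_eq_0_iff free_ultrafilter_not_bot)
  obtain c where c: "\<And>i. coeff g i = star (c i)"
    using assms(2) unfolding star_def image_iff by metis
  define r where "r = (\<Sum>i\<le>degree g. monom (c i) i)"
  have "ultra (\<lambda>n. poly r (t n)) = poly g (ultra t)"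
  proof -
    have "ultra (\<lambda>n. t n ^ i) = ultra t ^ i" for i
      by (induction i) (simp_all add: ultra_1 ultra_mult)
    then show ?thesis
      by (simp add: r_def poly_sum poly_monom ultra_sum ultra_mult poly_altdef[of g] c star_def)
  qed
  then have ev: "\<forall>\<^sub>F n in free_ultrafilter. poly r (t n) = 0"
    using assms(3) by (simp add: ultra_eq_0_iff)
  have "r = 0"
  proof (rule ccontr)
    assume "r \<noteq> 0"
    then have "finite (t -` {x. poly r x = 0})"
      using poly_roots_finite \<open>inj t\<close> by (intro finite_vimageI) auto
    then have "\<forall>\<^sub>F n in sequentially. poly r (t n) \<noteq> 0"
      by (simp add: vimage_def eventually_cofinite flip: cofinite_eq_sequentially)
    then have "\<forall>\<^sub>F n in free_ultrafilter. poly r (t n) \<noteq> 0"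
      using free_ultrafilter_le by (rule filter_leD[rotated])
    with ev have "\<forall>\<^sub>F n in free_ultrafilter. False"
      by (auto elim: eventually_elim2)
    then show False
      by (simp add: free_ultrafilter_not_bot)
  qed
  moreover have "coeff r (degree g) = c (degree g)"
    by (simp add: r_def coeff_sum)
  ultimately show ?thesis
    using c[of "degree g"] star_0[of 0] by simp
qed

section \<open>Critical values of polynomials\<close>

text \<open>The ultrapower of \<open>f\<close>, evaluated at the class of \<open>w\<close>, is built from the constants and the
  coordinates by ring operations, so the value of a derivation there is determined by its values at
  those. The derivative of \<open>f\<close> is produced in the same induction, because both obey the Leibniz rule.\<close>

lemma polynomial_chain_rule:
  fixes w :: "nat \<Rightarrow> 'b::euclidean_space"
  assumes "subring_derivation L D"
    and const: "\<And>c. ultra (\<lambda>_. c) \<in> L" "\<And>c. D (ultra (\<lambda>_. c)) = 0"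
    and coord: "\<And>b. b \<in> Basis \<Longrightarrow> ultra (\<lambda>n. w n \<bullet> b) \<in> L"
    and "real_polynomial_function f"
  shows "\<exists>f'. (\<forall>v. (f has_derivative f' v) (at v)) \<and> ultra (\<lambda>n. f (w n)) \<in> L \<and>
    D (ultra (\<lambda>n. f (w n))) = (\<Sum>b\<in>Basis. ultra (\<lambda>n. f' (w n) b) * D (ultra (\<lambda>n. w n \<bullet> b)))"
  using assms(5)
proof (induction f rule: real_polynomial_function.induct)
  interpret subring_derivation L D by fact
  {
    case (linear f)
    have "f v = (\<Sum>b\<in>Basis. f b * (v \<bullet> b))" for v
    proof -
      have "f v = f (\<Sum>b\<in>Basis. (v \<bullet> b) *\<^sub>R b)"
        by (simp add: euclidean_representation)
      also have "\<dots> = (\<Sum>b\<in>Basis. f b * (v \<bullet> b))"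
        using bounded_linear.linear[OF linear]
        by (simp add: linear_sum linear_cmul mult.commute)
      finally show ?thesis .
    qed
    then have "(\<lambda>n. f (w n)) = (\<lambda>n. \<Sum>b\<in>Basis. f b * (w n \<bullet> b))"
      by blast
    then have eq: "ultra (\<lambda>n. f (w n)) = (\<Sum>b\<in>Basis. ultra (\<lambda>_. f b) * ultra (\<lambda>n. w n \<bullet> b))"
      by (simp only: ultra_sum ultra_mult)
    have terms: "ultra (\<lambda>_. f b) * ultra (\<lambda>n. w n \<bullet> b) \<in> L" if "b \<in> Basis" for b
      using that by (intro mult_closed const coord)
    show ?case
    proof (intro exI[of _ "\<lambda>_. f"] conjI allI)
      show "(f has_derivative f) (at v)" for v
        by (rule bounded_linear_imp_has_derivative) (rule linear)
      show "ultra (\<lambda>n. f (w n)) \<in> L"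
        unfolding eq by (intro sum_closed terms)
      show "D (ultra (\<lambda>n. f (w n))) = (\<Sum>b\<in>Basis. ultra (\<lambda>_. f b) * D (ultra (\<lambda>n. w n \<bullet> b)))"
        unfolding eq by (simp add: D_sum terms D_mult const coord)
    qed
  next
    case (const c)
    show ?case
      by (intro exI[of _ "\<lambda>_ _. 0"] conjI allI has_derivative_const)
        (simp_all add: assms(2,3) ultra_0)
  next
    case (add f g)
    then obtain f' g' where
      f: "\<And>v. (f has_derivative f' v) (at v)" "ultra (\<lambda>n. f (w n)) \<in> L"
        "D (ultra (\<lambda>n. f (w n))) = (\<Sum>b\<in>Basis. ultra (\<lambda>n. f' (w n) b) * D (ultra (\<lambda>n. w n \<bullet> b)))"
      and g: "\<And>v. (g has_derivative g' v) (at v)" "ultra (\<lambda>n. g (w n)) \<in> L"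
        "D (ultra (\<lambda>n. g (w n))) = (\<Sum>b\<in>Basis. ultra (\<lambda>n. g' (w n) b) * D (ultra (\<lambda>n. w n \<bullet> b)))"
      by blast
    show ?case
    proof (intro exI[of _ "\<lambda>v b. f' v b + g' v b"] conjI allI)
      show "((\<lambda>v. f v + g v) has_derivative (\<lambda>b. f' v b + g' v b)) (at v)" for v
        by (intro has_derivative_add f g)
    qed (simp_all add: ultra_add add_closed D_add f g distrib_right sum.distrib)
  next
    case (mult f g)
    then obtain f' g' where
      f: "\<And>v. (f has_derivative f' v) (at v)" "ultra (\<lambda>n. f (w n)) \<in> L"
        "D (ultra (\<lambda>n. f (w n))) = (\<Sum>b\<in>Basis. ultra (\<lambda>n. f' (w n) b) * D (ultra (\<lambda>n. w n \<bullet> b)))"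
      and g: "\<And>v. (g has_derivative g' v) (at v)" "ultra (\<lambda>n. g (w n)) \<in> L"
        "D (ultra (\<lambda>n. g (w n))) = (\<Sum>b\<in>Basis. ultra (\<lambda>n. g' (w n) b) * D (ultra (\<lambda>n. w n \<bullet> b)))"
      by blast
    show ?case
    proof (intro exI[of _ "\<lambda>v b. f v * g' v b + f' v b * g v"] conjI allI)
      show "((\<lambda>v. f v * g v) has_derivative (\<lambda>b. f v * g' v b + f' v b * g v)) (at v)" for v
        by (intro has_derivative_mult f g)
      show "D (ultra (\<lambda>n. f (w n) * g (w n))) =
          (\<Sum>b\<in>Basis. ultra (\<lambda>n. f (w n) * g' (w n) b + f' (w n) b * g (w n)) * D (ultra (\<lambda>n. w n \<bullet> b)))"
        by (simp add: ultra_add ultra_mult D_mult f g sum_distrib_left sum_distrib_right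
            distrib_left distrib_right sum.distrib ac_simps)
    qed (simp add: ultra_mult mult_closed f g)
  }
qed

text \<open>An algebraic form of Sard's theorem: the values at infinitely many critical points cannot be
  pairwise distinct, since their class would be a transcendental element on which every derivation
  trivial on the constants vanishes.\<close>

theorem finite_critical_values:
  fixes p :: "'b::euclidean_space \<Rightarrow> real"
  assumes "real_polynomial_function p"
  shows "finite (p ` {w. (p has_derivative (\<lambda>_. 0)) (at w)})"
proof (rule ccontr)
  assume "infinite (p ` {w. (p has_derivative (\<lambda>_. 0)) (at w)})"
  then obtain t :: "nat \<Rightarrow> real" where t: "inj t"
      "range t \<subseteq> p ` {w. (p has_derivative (\<lambda>_. 0)) (at w)}"
    using infinite_countable_subset by blast
  then have "\<exists>w. \<forall>n. (p has_derivative (\<lambda>_. 0)) (at (w n)) \<and> p (w n) = t n"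
  proof (intro choice allI)
    fix n
    have "t n \<in> p ` {w. (p has_derivative (\<lambda>_. 0)) (at w)}"
      using t(2) by blast
    then show "\<exists>w. (p has_derivative (\<lambda>_. 0)) (at w) \<and> p w = t n"
      by auto
  qed
  then obtain w where w: "\<And>n. (p has_derivative (\<lambda>_. 0)) (at (w n))" "\<And>n. p (w n) = t n"
    by blast
  define k where "k = range (\<lambda>c. ultra (\<lambda>_. c))"
  have "\<exists>L D. subring_derivation L D \<and> k \<subseteq> L \<and> (\<lambda>b. ultra (\<lambda>n. w n \<bullet> b)) ` Basis \<subseteq> L \<and>
      ultra t \<in> L \<and> (\<forall>c\<in>k. D c = 0) \<and> D (ultra t) = 1"
  proof (rule derivation_of_transcendental)
    show "1 \<in> k"
      by (auto simp: k_def simp flip: ultra_1)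
    show "a - b \<in> k \<and> a * b \<in> k" if "a \<in> k" "b \<in> k" for a b
      using that by (auto simp: k_def simp flip: ultra_diff ultra_mult)
    show "g = 0" if "\<And>i. coeff g i \<in> k" "poly g (ultra t) = 0" for g
      using ultra_transcendental[OF t(1)] that unfolding k_def by blast
  qed simp
  then obtain L D where D: "subring_derivation L D" "k \<subseteq> L"
      "\<And>b. b \<in> Basis \<Longrightarrow> ultra (\<lambda>n. w n \<bullet> b) \<in> L"
      "\<And>c. c \<in> k \<Longrightarrow> D c = 0" "D (ultra t) = 1"
    by blast
  obtain p' where p': "\<And>v. (p has_derivative p' v) (at v)"
    and chain: "D (ultra (\<lambda>n. p (w n))) =
      (\<Sum>b\<in>Basis. ultra (\<lambda>n. p' (w n) b) * D (ultra (\<lambda>n. w n \<bullet> b)))"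
    using polynomial_chain_rule[OF D(1) _ _ D(3) assms] D(2,4) unfolding k_def by blast
  have "p' (w n) = (\<lambda>_. 0)" for n
    using p' w(1) has_derivative_unique by blast
  then have "D (ultra t) = 0"
    using chain by (simp add: w(2) ultra_0)
  with D(5) show False by simp
qed

section \<open>Global minimum points in a box\<close>

lemma partial_derivatives_eq:
  assumes "(p has_derivative p') (at (x, y, z))"
  shows "dx p (x, y, z) = p' (1, 0, 0)" "dy p (x, y, z) = p' (0, 1, 0)" "dz p (x, y, z) = p' (0, 0, 1)"
proof -
  have lin: "linear p'"
    using assms has_derivative_linear by blast
  have along_line: "deriv (\<lambda>t. p (c t)) s = p' v"
    if "c s = (x, y, z)" "(c has_derivative (\<lambda>h. h *\<^sub>R v)) (at s)" for c s v
  proof -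
    have "((\<lambda>t. p (c t)) has_derivative (\<lambda>h. p' (h *\<^sub>R v))) (at s)"
      using has_derivative_compose[OF that(2), of p p'] assms that(1) by simp
    then have "((\<lambda>t. p (c t)) has_field_derivative p' v) (at s)"
      using lin by (simp add: has_field_derivative_def linear_cmul mult.commute[of _ "p' v"])
    then show ?thesis by (rule DERIV_imp_deriv)
  qed
  show "dx p (x, y, z) = p' (1, 0, 0)"
    unfolding dx_def prod.case
    by (rule along_line) (auto simp: zero_prod_def intro!: derivative_eq_intros)
  show "dy p (x, y, z) = p' (0, 1, 0)"
    unfolding dy_def prod.case
    by (rule along_line) (auto simp: zero_prod_def intro!: derivative_eq_intros)
  show "dz p (x, y, z) = p' (0, 0, 1)"
    unfolding dz_def prod.case
    by (rule along_line) (auto simp: zero_prod_def intro!: derivative_eq_intros)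
qed

lemma critical_iff:
  assumes "p differentiable (at w)"
  shows "dx p w = 0 \<and> dy p w = 0 \<and> dz p w = 0 \<longleftrightarrow> (p has_derivative (\<lambda>_. 0)) (at w)"
proof -
  obtain x y z where w: "w = (x, y, z)" by (metis surj_pair)
  obtain p' where p': "(p has_derivative p') (at w)"
    using assms by (auto simp: differentiable_def)
  then have lin: "linear p'"
    using has_derivative_linear by blast
  have expand: "p' (r, s, t) = r * p' (1, 0, 0) + s * p' (0, 1, 0) + t * p' (0, 0, 1)" for r s t
  proof -
    have "(r, s, t) = r *\<^sub>R (1, 0, 0) + s *\<^sub>R (0, 1, 0) + t *\<^sub>R (0, 0, 1 :: real)"
      by simp
    then show ?thesis
      using lin by (simp only: linear_add linear_cmul real_scaleR_def)
  qed
  show ?thesis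
  proof (intro iffI conjI)
    assume "dx p w = 0 \<and> dy p w = 0 \<and> dz p w = 0"
    then have "p' (1, 0, 0) = 0" "p' (0, 1, 0) = 0" "p' (0, 0, 1) = 0"
      using partial_derivatives_eq[OF p'[unfolded w]] by (simp_all add: w)
    then have "p' v = 0" for v
      using expand[of "fst v" "fst (snd v)" "snd (snd v)"] by simp
    then have "p' = (\<lambda>_. 0)"
      by blast
    with p' show "(p has_derivative (\<lambda>_. 0)) (at w)"
      by simp
  next
    assume "(p has_derivative (\<lambda>_. 0)) (at w)"
    then show "dx p w = 0" "dy p w = 0" "dz p w = 0"
      using partial_derivatives_eq[of p "\<lambda>_. 0" x y z] by (simp_all add: w)
  qed
qed

theorem mainTheorem3:
  fixes p :: "real \<times> real \<times> real \<Rightarrow> real"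
    and a1 a2 b1 b2 c1 c2 :: real
  defines "B \<equiv> Pi_box a1 a2 b1 b2 c1 c2"
    and "bdB \<equiv> bd_box a1 a2 b1 b2 c1 c2"
  defines "xstar \<equiv> least_elem {x. \<exists>y z. (x, y, z) \<in> Argmin p B}"
  assumes "real_polynomial_function p"
    and "a1 < a2" and "b1 < b2" and "c1 < c2"
  shows "bdB \<inter> Argmin p B \<noteq> {} \<or>
    (bdB \<inter> Argmin p B = {} \<and>
     xstar \<in> local_min_values (\<lambda>(x, y, z). x)
       {w. dx p w = 0 \<and> dy p w = 0 \<and> dz p w = 0})"
proof (cases "bdB \<inter> Argmin p B = {}")
  case False
  then show ?thesis by blast
next
  case no_bd: True
  define C where "C = {w. (p has_derivative (\<lambda>_. 0)) (at w)}"
  have crit: "{w. dx p w = 0 \<and> dy p w = 0 \<and> dz p w = 0} = C"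
    unfolding C_def using critical_iff differentiable_at_real_polynomial_function[OF assms(4)] by blast
  have cont: "continuous_on S p" for S
    using assms(4) continuous_on_polymonial_function[of p S] by (simp add: real_polynomial_function_eq)
  have "compact B"
    unfolding B_def by (rule compact_Pi_box)
  have "(a1, b1, c1) \<in> B"
    using assms by (simp add: B_def Pi_box_def)
  then have "B \<noteq> {}" by blast
  have least: "p w \<le> p u" if "w \<in> Argmin p B" "u \<in> B" for w u
    using least_elem_compact(2)[of "p ` B"] compact_continuous_image[OF cont \<open>compact B\<close>] that
    by (auto simp: Argmin_def)
  have shadow: "{x. \<exists>y z. (x, y, z) \<in> Argmin p B} = fst ` Argmin p B"
    by force
  have "compact (fst ` Argmin p B)" "fst ` Argmin p B \<noteq> {}"
    using compact_Argmin[OF \<open>compact B\<close> \<open>B \<noteq> {}\<close> cont]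
    by (auto intro!: compact_continuous_image[OF continuous_on_fst] continuous_on_id)
  then have xstar: "xstar \<in> fst ` Argmin p B" "\<And>u. u \<in> Argmin p B \<Longrightarrow> xstar \<le> fst u"
    unfolding xstar_def shadow using least_elem_compact by auto
  then obtain w where w: "w \<in> Argmin p B" "xstar = fst w"
    by blast
  define V\<^sub>0 where "V\<^sub>0 = {a1<..<a2} \<times> {b1<..<b2} \<times> {c1<..<c2}"
  have "open V\<^sub>0"
    unfolding V\<^sub>0_def by (intro open_Times) auto
  have "V\<^sub>0 \<subseteq> B"
    by (auto simp: V\<^sub>0_def B_def Pi_box_def)
  have "w \<in> V\<^sub>0"
  proof -
    obtain x y z where xyz: "w = (x, y, z)" by (metis surj_pair)
    moreover have "w \<in> B" "w \<notin> bdB"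
      using w(1) no_bd by (auto simp: Argmin_def)
    ultimately show ?thesis
      by (auto simp: V\<^sub>0_def B_def bdB_def bd_box_def Pi_box_def)
  qed
  have "w \<in> C"
  proof -
    obtain p' where p': "(p has_derivative p') (at w)"
      using differentiable_at_real_polynomial_function[OF assms(4), of w UNIV]
      unfolding differentiable_def by blast
    have "p' = (\<lambda>_. 0)"
      using \<open>w \<in> V\<^sub>0\<close> \<open>open V\<^sub>0\<close> p'
    proof (rule differential_zero_maxmin)
      show "(\<forall>u\<in>V\<^sub>0. p u \<le> p w) \<or> (\<forall>u\<in>V\<^sub>0. p w \<le> p u)"
        using least[OF w(1)] \<open>V\<^sub>0 \<subseteq> B\<close> by blast
    qed
    with p' show ?thesis by (simp add: C_def)
  qed
  \<comment> \<open>In \<open>V\<close> the only critical value left is that of \<open>w\<close>.\<close>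
  define V where "V = V\<^sub>0 \<inter> p -` (- (p ` C - {p w}))"
  have "finite (p ` C)"
    unfolding C_def by (rule finite_critical_values) fact
  then have "open (p -` (- (p ` C - {p w})))"
    by (intro open_vimage cont open_Compl finite_imp_closed) simp
  then have "open V"
    unfolding V_def using \<open>open V\<^sub>0\<close> by blast
  moreover have "w \<in> V"
    using \<open>w \<in> V\<^sub>0\<close> by (simp add: V_def)
  moreover have "fst w \<le> fst u" if "u \<in> C" "u \<in> V" for u
  proof -
    have "u \<in> B" "p u = p w"
      using that \<open>V\<^sub>0 \<subseteq> B\<close> by (auto simp: V_def)
    then have "u \<in> Argmin p B"
      using w(1) by (simp add: Argmin_def)
    then show ?thesis
      using xstar(2) w(2) by simp
  qed
  ultimately have "local_min_point (\<lambda>(x, y, z). x) C w"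
    using \<open>w \<in> C\<close> by (auto simp: local_min_point_def split_beta intro!: exI[of _ V])
  then have "xstar \<in> local_min_values (\<lambda>(x, y, z). x) C"
    unfolding local_min_values_def w(2) by (intro CollectI exI[of _ w]) (simp add: split_beta)
  then show ?thesis
    using no_bd crit by simp
qed

end
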